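(* Let $L\subseteq \mathbf{Z}_2^n$ be a linear binary code of dimension $k$ such that the edge-colored graph $A=I^n_c/L$ is an adinkraizable chromotopology. Then the number of even dashings of $A$ and the number of odd dashings of $A$ are both equal to \[ |e(A)| = |o(A)| = 2^{2^{n-k}+k-1}. \]
   Context: A (linear binary) code is a $\mathbf{Z}_2$-subspace $L\subseteq\mathbf{Z}_2^n$; it is an $(n,k)$-code if $\dim L=k$. Let $e_i\in\mathbf{Z}_2^n$ be the $i$-th standard basis vector. The quotient $I^n_c/L$ is the edge-colored multigraph whose vertex set is $\mathbf{Z}_2^n/L$ and which has, for each coset $C$ and each color $i\in[n]=\{1,\dots,n\}$, an edge of color $i$ joining $C$ and $C+e_i$ (one edge of color $i$ per such unordered pair; it is a loop if $e_i\in L$). For a vertex $v$ let $q_i(v)$ be the other endpoint of the color-$i$ edge at $v$. A chromotopology of dimension $n$ is a finite connected simple bipartite graph in which every vertex has degree $n$, with edges colored by $[n]$ so that every vertex is incident to exactly one edge of each color, and such that for any distinct colors $i,j$ the edges of colors $i$ and $j$ form a disjoint union of $4$-cycles (these are the $2$-colored $4$-cycles). A dashing is a map $d\colon E(A)\to\mathbf{Z}_2$; it is odd (resp. even) if the sum of $d$ over the edges of every $2$-colored $4$-cycle is $1$ (resp. $0$). $o(A)$ and $e(A)$ denote the sets of odd and even dashings. A ranking of $A$ is a function $h\colon V(A)\to\mathbf{Z}$ with $|h(u)-h(w)|=1$ for every edge $\{u,w\}$ (this makes $A$ the Hasse diagram of a ranked poset). $A$ is adinkraizable if it admits both an odd dashing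 and a ranking. *)

theory Defs
  imports "HOL-Analysis.Cartesian_Space" "HOL-Library.Z2" "HOL-Library.FuncSet"
begin

section \<open>Edge-colored multigraphs\<close>

text \<open>\<open>ends e\<close> is the set of endpoints of \<open>e\<close>: a two-element set, or a singleton if \<open>e\<close> is a loop.\<close>

record ('v, 'e, 'c) colored_graph =
  verts :: "'v set"
  edges :: "'e set"
  ends :: "'e \<Rightarrow> 'v set"
  color :: "'e \<Rightarrow> 'c"

definition multigraph :: "('v, 'e, 'c) colored_graph \<Rightarrow> bool" where
  "multigraph A \<longleftrightarrow>
     (\<forall>e\<in>edges A. \<exists>u\<in>verts A. \<exists>w\<in>verts A. ends A e = {u, w})"

definition simple_graph :: "('v, 'e, 'c) colored_graph \<Rightarrow> bool" where
  "simple_graph A \<longleftrightarrow>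
     multigraph A \<and> (\<forall>e\<in>edges A. card (ends A e) = 2) \<and> inj_on (ends A) (edges A)"

definition connected_graph :: "('v, 'e, 'c) colored_graph \<Rightarrow> bool" where
  "connected_graph A \<longleftrightarrow>
     verts A \<noteq> {} \<and>
     (\<forall>u\<in>verts A. \<forall>w\<in>verts A. (u, w) \<in> {(a, b). \<exists>e\<in>edges A. ends A e = {a, b}}\<^sup>*)"

definition bipartite :: "('v, 'e, 'c) colored_graph \<Rightarrow> bool" where
  "bipartite A \<longleftrightarrow>
     (\<exists>X Y. X \<union> Y = verts A \<and> X \<inter> Y = {} \<and>
        (\<forall>e\<in>edges A. \<exists>x\<in>X. \<exists>y\<in>Y. ends A e = {x, y}))"

text \<open>A 4-cycle is represented by its set of edges.\<close>

definition four_cycle :: "('v, 'e, 'c) colored_graph \<Rightarrow> 'e set \<Rightarrow> bool" where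
  "four_cycle A F \<longleftrightarrow>
     (\<exists>e1 e2 e3 e4 v1 v2 v3 v4.
        distinct [v1, v2, v3, v4] \<and> F = {e1, e2, e3, e4} \<and> F \<subseteq> edges A \<and>
        ends A e1 = {v1, v2} \<and> ends A e2 = {v2, v3} \<and>
        ends A e3 = {v3, v4} \<and> ends A e4 = {v4, v1})"

definition disjoint_union_of_four_cycles ::
    "('v, 'e, 'c) colored_graph \<Rightarrow> 'e set \<Rightarrow> bool" where
  "disjoint_union_of_four_cycles A E \<longleftrightarrow>
     (\<exists>P. (\<forall>F\<in>P. four_cycle A F) \<and> \<Union>P = E \<and>
        (\<forall>F\<in>P. \<forall>F'\<in>P. F \<noteq> F' \<longrightarrow> \<Union>(ends A ` F) \<inter> \<Union>(ends A ` F') = {}))"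

section \<open>Chromotopologies, dashings and rankings\<close>

text \<open>The colors are the elements of the finite type \<open>'c\<close>, so the dimension \<open>n\<close> is \<open>CARD('c)\<close>.\<close>

definition chromotopology :: "('v, 'e, 'c::finite) colored_graph \<Rightarrow> bool" where
  "chromotopology A \<longleftrightarrow>
     finite (verts A) \<and> finite (edges A) \<and>
     simple_graph A \<and> connected_graph A \<and> bipartite A \<and>
     (\<forall>v\<in>verts A. card {e \<in> edges A. v \<in> ends A e} = CARD('c)) \<and>
     (\<forall>v\<in>verts A. \<forall>i. \<exists>!e. e \<in> edges A \<and> v \<in> ends A e \<and> color A e = i) \<and>
     (\<forall>i j. i \<noteq> j \<longrightarrow>
        disjoint_union_of_four_cycles A {e \<in> edges A. color A e = i \<or> color A e = j})"

text \<open>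
  In a chromotopology every 4-cycle using exactly the two colors \<open>i\<close> and \<open>j\<close> alternates between
  them, hence is one of the 4-cycles whose disjoint union is formed by the edges of these colors.
\<close>

definition two_colored_four_cycles :: "('v, 'e, 'c) colored_graph \<Rightarrow> 'e set set" where
  "two_colored_four_cycles A =
     {F. four_cycle A F \<and> (\<exists>i j. i \<noteq> j \<and> color A ` F = {i, j})}"

text \<open>Dashings are extensional functions, so that maps on the edge set are counted correctly.\<close>

definition dashings :: "('v, 'e, 'c) colored_graph \<Rightarrow> ('e \<Rightarrow> bit) set" where
  "dashings A = edges A \<rightarrow>\<^sub>E UNIV"

definition odd_dashings :: "('v, 'e, 'c) colored_graph \<Rightarrow> ('e \<Rightarrow> bit) set" where
  "odd_dashings A =
     {d \<in> dashings A. \<forall>F\<in>two_colored_four_cycles A. (\<Sum>e\<in>F. d e) = 1}"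

definition even_dashings :: "('v, 'e, 'c) colored_graph \<Rightarrow> ('e \<Rightarrow> bit) set" where
  "even_dashings A =
     {d \<in> dashings A. \<forall>F\<in>two_colored_four_cycles A. (\<Sum>e\<in>F. d e) = 0}"

definition ranking :: "('v, 'e, 'c) colored_graph \<Rightarrow> ('v \<Rightarrow> int) \<Rightarrow> bool" where
  "ranking A h \<longleftrightarrow> (\<forall>e\<in>edges A. \<forall>u w. ends A e = {u, w} \<longrightarrow> \<bar>h u - h w\<bar> = 1)"

definition adinkraizable :: "('v, 'e, 'c) colored_graph \<Rightarrow> bool" where
  "adinkraizable A \<longleftrightarrow> odd_dashings A \<noteq> {} \<and> (\<exists>h. ranking A h)"

section \<open>Codes and quotients of the colored cube\<close>

definition linear_code :: "(bit ^ 'n) set \<Rightarrow> bool" where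
  "linear_code L \<longleftrightarrow> vec.subspace L"

definition cosets :: "(bit ^ 'n) set \<Rightarrow> (bit ^ 'n) set set" where
  "cosets L = range (\<lambda>x. (\<lambda>y. x + y) ` L)"

definition translate :: "(bit ^ 'n) set \<Rightarrow> 'n \<Rightarrow> (bit ^ 'n) set" where
  "translate C i = (\<lambda>x. x + axis i 1) ` C"

text \<open>
  The edge of color \<open>i\<close> joining \<open>C\<close> and \<open>C + e\<^sub>i\<close> is the pair \<open>(i, {C, C + e\<^sub>i})\<close>.
\<close>

definition quotient_cube ::
    "(bit ^ 'n) set \<Rightarrow> ((bit ^ 'n) set, 'n \<times> (bit ^ 'n) set set, 'n) colored_graph" where
  "quotient_cube L =
     \<lparr>verts = cosets L,
      edges = {(i, {C, translate C i}) | i C. C \<in> cosets L},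
      ends = snd,
      color = fst\<rparr>"

end

(*
  An even dashing of the quotient is a closed 1-cochain. Lifted to the cube it is the
  coboundary of a unique potential p with p 0 = 0, and invariance under L means that
  p (x + l) = p x + p l for l in L. Such a p is the sum of a function on the cosets vanishing at L,
  which contributes 2^(2^(n-k) - 1) choices, and of a linear functional on the cube chosen once for
  each functional on L, which contributes 2^k. Adding a fixed odd dashing exchanges even and odd
  dashings.
*)

theory Submission imports Defs begin

text \<open>This keeps sums of bits additive instead of turning them into \<open>XOR\<close>, so
  that the rules for commutative groups apply.\<close>

declare add_bit_eq_xor [simp del] minus_bit_def [simp del]

section \<open>Linear algebra over the field with two elements\<close>

lemma UNIV_bit: "(UNIV::bit set) = {0, 1}"
  using bit.exhaust by auto

instance bit :: finite
  by standard (simp add: UNIV_bit)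

lemma ex_bit: "(\<exists>c::bit. P c) \<longleftrightarrow> P 0 \<or> P 1"
  by (metis bit.exhaust)

lemma bit_add_self: "(a::bit) + a = 0"
  by (cases a) (simp_all add: add_bit_eq_xor)

lemma bit_add_left_self: "(a::bit) + (a + b) = b"
  by (simp add: add.assoc[symmetric] bit_add_self)

lemma bit_sum4_eq_0_iff: "(a::bit) + b + c + d = 0 \<longleftrightarrow> a + b = d + c"
  by (cases a; cases b; cases c; cases d) (simp_all add: add_bit_eq_xor)

text \<open>Sorting a sum and cancelling equal neighbours proves identities in characteristic two by
  normalization.\<close>

lemmas bit_ac = ac_simps bit_add_self bit_add_left_self

lemma vec_add_self: "(x::bit ^ 'n) + x = 0"
  by (simp add: vec_eq_iff bit_add_self)

lemma vec_add_left_self: "(x::bit ^ 'n) + (x + y) = y"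
  by (simp add: add.assoc[symmetric] vec_add_self)

lemmas vec_ac = ac_simps vec_add_self vec_add_left_self

lemma vec_diff_eq_add: "(x::bit ^ 'n) - y = x + y"
  by (simp add: vec_eq_iff minus_bit_def)

text \<open>The scalars are 0 and 1, so a step of span induction either changes nothing or adds one
  basis vector. In graph terms, every vertex of the cube is reached from 0 along edges.\<close>

lemma bit_vec_axis_induct [case_names zero axis]:
  fixes x :: "bit ^ 'n::finite"
  assumes "P 0" and "\<And>x i. P x \<Longrightarrow> P (x + axis i 1)"
  shows "P x"
proof -
  have "x \<in> vec.span cart_basis"
    by (simp add: span_cart_basis)
  then show ?thesis
  proof (induction rule: vec.span_induct_alt)
    case base
    then show ?case by (rule assms)
  next
    case (step c b y)
    then obtain i where b: "b = axis i 1"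
      by (auto simp: cart_basis_def)
    consider "c = 0" | "c = 1" by (cases c)
    then show ?case
      by cases (use step assms(2)[of y i] b in \<open>simp_all add: add.commute\<close>)
  qed
qed

text \<open>A new independent vector \<open>b\<close> doubles the span: it adds the translate by
  \<open>b\<close>, which is disjoint from the old span.\<close>

lemma card_span_independent_bit:
  fixes B :: "(bit ^ 'n::finite) set"
  assumes "vec.independent B"
  shows "card (vec.span B) = 2 ^ card B"
proof -
  have "finite B" by simp
  then show ?thesis using assms
  proof (induction B rule: finite_induct)
    case empty
    then show ?case by simp
  next
    case (insert b B)
    have b: "b \<notin> vec.span B" and ind: "vec.independent B"
      using insert by (auto simp: vec.independent_insert)
    have eq: "vec.span (insert b B) = vec.span B \<union> (\<lambda>x. x + b) ` vec.span B"
    proof (intro set_eqI)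
      fix x
      have "x \<in> vec.span (insert b B) \<longleftrightarrow> (\<exists>c. x + c *s b \<in> vec.span B)"
        by (simp add: vec.span_breakdown_eq vec_diff_eq_add)
      also have "\<dots> \<longleftrightarrow> x \<in> vec.span B \<or> x + b \<in> vec.span B"
        by (simp add: ex_bit)
      also have "\<dots> \<longleftrightarrow> x \<in> vec.span B \<union> (\<lambda>x. x + b) ` vec.span B"
      proof -
        have "x \<in> (\<lambda>x. x + b) ` vec.span B" if "x + b \<in> vec.span B"
          using that by (intro image_eqI[of _ _ "x + b"]) (simp_all add: add.assoc vec_add_self)
        moreover have "x + b \<in> vec.span B" if "x \<in> (\<lambda>x. x + b) ` vec.span B"
          using that by (auto simp: add.assoc vec_add_self)
        ultimately show ?thesis by blast
      qed
      finally show "x \<in> vec.span (insert b B)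
          \<longleftrightarrow> x \<in> vec.span B \<union> (\<lambda>x. x + b) ` vec.span B" .
    qed
    have "vec.span B \<inter> (\<lambda>x. x + b) ` vec.span B = {}"
      using b by (auto simp: vec.span_add_eq)
    then show ?case
      using insert ind
      by (simp add: eq card_Un_disjoint card_image inj_on_def)
  qed
qed

lemma additive_extension:
  fixes B :: "(bit ^ 'n::finite) set" and \<beta> :: "bit ^ 'n \<Rightarrow> bit"
  assumes "vec.independent B"
  shows "\<exists>\<phi>. (\<forall>x y. \<phi> (x + y) = \<phi> x + \<phi> y) \<and> (\<forall>b\<in>B. \<phi> b = \<beta> b)"
proof -
  \<comment> \<open>A prescribed bit is encoded as the constant vector with that entry. Any
    coordinate of \<open>g\<close> then recovers it, so the arbitrary index \<open>undefined\<close>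
    will do below.\<close>
  obtain g :: "bit ^ 'n \<Rightarrow> bit ^ 'n" where g: "Vector_Spaces.linear (*s) (*s) g"
    and gB: "\<forall>b\<in>B. g b = (\<chi> i. \<beta> b)"
    using vec.linear_independent_extend[OF assms, of "\<lambda>b. \<chi> i. \<beta> b"] by blast
  interpret g: Vector_Spaces.linear "(*s)" "(*s)" g by (rule g)
  show ?thesis
    by (rule exI[of _ "\<lambda>x. g x $ undefined"]) (simp add: g.add gB)
qed

text \<open>Additivity is assumed only for increments from \<open>B\<close>, so this applies to the
  potential of an even dashing, which is additive along the code but in general not on the whole
  cube.\<close>

lemma additive_eq_on_span:
  fixes \<phi> \<psi> :: "bit ^ 'n::finite \<Rightarrow> bit"
  assumes "\<phi> 0 = 0" "\<psi> 0 = 0"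
    and "\<And>x y. y \<in> B \<Longrightarrow> \<phi> (x + y) = \<phi> x + \<phi> y"
    and "\<And>x y. y \<in> B \<Longrightarrow> \<psi> (x + y) = \<psi> x + \<psi> y"
    and "\<And>b. b \<in> B \<Longrightarrow> \<phi> b = \<psi> b"
    and "x \<in> vec.span B"
  shows "\<phi> x = \<psi> x"
  using assms(6)
proof (induction rule: vec.span_induct_alt)
  case base
  then show ?case using assms by simp
next
  case (step c b y)
  then show ?case
    by (cases c) (simp_all add: assms(3-5) add.commute[of b])
qed

section \<open>Potentials on the cube\<close>

text \<open>
  A closed 1-cochain on the cube is exact: the coordinate directions are treated one at a time,
  correcting the potential by \<open>x\<^sub>j f(x, j)\<close>, where \<open>f\<close> is the cochain already made zero in
  the previous directions.
\<close>

lemma cube_potential_on: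
  fixes f :: "bit ^ 'n::finite \<Rightarrow> 'n \<Rightarrow> bit"
  assumes "finite S"
    and "\<And>x i. f (x + axis i 1) i = f x i"
    and "\<And>x i j. f x i + f (x + axis i 1) j = f x j + f (x + axis j 1) i"
  shows "\<exists>p. \<forall>x. \<forall>i\<in>S. p (x + axis i 1) = p x + f x i"
  using assms(1)
proof (induction S rule: finite_induct)
  case empty
  then show ?case by simp
next
  case (insert j S)
  then obtain p where p: "\<And>x i. i \<in> S \<Longrightarrow> p (x + axis i 1) = p x + f x i"
    by blast
  \<comment> \<open>\<open>r\<close> is the error that \<open>p\<close> still makes in direction
    \<open>j\<close>. Closedness makes it invariant under steps in \<open>S\<close>, and it is also
    invariant under steps in direction \<open>j\<close>. Adding it on the half of the cube with
    \<open>x $ j = 1\<close> therefore repairs direction \<open>j\<close> and leaves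
    \<open>S\<close> intact.\<close>
  define r where "r x = f x j + p x + p (x + axis j 1)" for x
  define q where "q x = (if x $ j = 1 then r x else 0)" for x
  have r_j: "r (x + axis j 1) = r x" for x
    by (simp add: r_def assms(2) vec_ac bit_ac)
  have r_S: "r (x + axis i 1) = r x" if "i \<in> S" for x i
  proof -
    have "f (x + axis i 1) j = f x i + (f x j + f (x + axis j 1) i)"
      using assms(3)[of x i j] by (metis bit_add_left_self)
    moreover have "p (x + axis i 1 + axis j 1) = p (x + axis j 1) + f (x + axis j 1) i"
      using p[OF that, of "x + axis j 1"] by (simp add: ac_simps)
    ultimately show ?thesis
      by (simp add: r_def p[OF that] bit_ac)
  qed
  have q_S: "q (x + axis i 1) = q x" if "i \<in> S" for x i
  proof -
    have "i \<noteq> j" using that insert by auto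
    then show ?thesis using r_S[OF that] by (simp add: q_def axis_def)
  qed
  have q_j: "q (x + axis j 1) = q x + r x" for x
    by (cases "x $ j") (simp_all add: q_def r_j bit_ac)
  show ?case
  proof (intro exI[of _ "\<lambda>x. p x + q x"] allI ballI)
    fix x i assume "i \<in> insert j S"
    then consider "i = j" | "i \<in> S" by blast
    then show "p (x + axis i 1) + q (x + axis i 1) = p x + q x + f x i"
    proof cases
      case 1
      then show ?thesis by (simp add: q_j) (simp add: r_def bit_ac)
    next
      case 2
      then show ?thesis by (simp add: q_S p bit_ac)
    qed
  qed
qed

lemma cube_potential:
  fixes f :: "bit ^ 'n::finite \<Rightarrow> 'n \<Rightarrow> bit"
  assumes "\<And>x i. f (x + axis i 1) i = f x i"
    and "\<And>x i j. f x i + f (x + axis i 1) j = f x j + f (x + axis j 1) i"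
  obtains p where "\<And>x i. p (x + axis i 1) = p x + f x i" and "p 0 = 0"
proof -
  obtain p where p: "\<forall>x. \<forall>i\<in>UNIV. p (x + axis i 1) = p x + f x i"
    using cube_potential_on[of UNIV f] assms by auto
  show ?thesis
    by (rule that[of "\<lambda>x. p x + p 0"]) (use p in \<open>auto simp: bit_ac\<close>)
qed

section \<open>Cosets and edges of the quotient\<close>

definition coset :: "(bit ^ 'n) set \<Rightarrow> bit ^ 'n \<Rightarrow> (bit ^ 'n) set" where
  "coset L x = (\<lambda>y. x + y) ` L"

lemma cosets_eq_range: "cosets L = range (coset L)"
  by (simp add: cosets_def coset_def)

lemma coset_eq_iff:
  assumes "vec.subspace L"
  shows "coset L x = coset L y \<longleftrightarrow> x + y \<in> (L::(bit ^ 'n::finite) set)"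
proof
  assume "coset L x = coset L y"
  moreover have "x \<in> coset L x"
    using vec.subspace_0[OF assms] by (auto simp: coset_def intro!: image_eqI[of _ _ 0])
  ultimately obtain l where "l \<in> L" "x = y + l" by (auto simp: coset_def)
  then show "x + y \<in> L" by (simp add: vec_ac)
next
  have sub: "coset L x \<subseteq> coset L y" if "x + y \<in> L" for x y
  proof
    fix z assume "z \<in> coset L x"
    then obtain l where l: "l \<in> L" "z = x + l" by (auto simp: coset_def)
    then have "(x + y) + l \<in> L"
      using that assms vec.subspace_add by blast
    then show "z \<in> coset L y"
      unfolding coset_def
      using l by (intro image_eqI[of _ _ "(x + y) + l"]) (simp_all add: vec_ac)
  qed
  assume "x + y \<in> L"
  then show "coset L x = coset L y"
    using sub[of x y] sub[of y x] by (simp add: add.commute)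
qed

lemma coset_0: "coset L 0 = L"
  by (simp add: coset_def)

lemma coset_add_cong: "coset L x = coset L y \<Longrightarrow> coset L (x + z) = coset L (y + z)"
proof -
  assume "coset L x = coset L y"
  then have "(\<lambda>v. z + v) ` coset L x = (\<lambda>v. z + v) ` coset L y" by simp
  then show ?thesis by (simp add: coset_def image_image ac_simps)
qed

lemma translate_coset: "translate (coset L x) i = coset L (x + axis i 1)"
  by (simp add: translate_def coset_def image_image ac_simps)

text \<open>Lagrange's theorem: the cosets partition the \<open>2 ^ CARD('n)\<close> vectors into
  classes of size \<open>2 ^ vec.dim L\<close>.\<close>

lemma card_cosets:
  fixes L :: "(bit ^ 'n::finite) set"
  assumes L: "vec.subspace L"
  shows "card (cosets L) = 2 ^ (CARD('n) - vec.dim L)"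
proof -
  obtain B where B: "B \<subseteq> L" "vec.independent B" "L \<subseteq> vec.span B" "card B = vec.dim L"
    using vec.basis_exists by blast
  then have "vec.span B = L"
    using L by (metis vec.span_minimal subset_antisym)
  then have cardL: "card L = 2 ^ vec.dim L"
    using card_span_independent_bit[OF B(2)] B(4) by simp
  have "card L * card (cosets L) = card (\<Union>(cosets L))"
  proof (rule card_partition)
    fix C assume "C \<in> cosets L"
    then show "card C = card L" by (auto simp: cosets_eq_range coset_def card_image)
  next
    fix C D assume "C \<in> cosets L" "D \<in> cosets L" and ne: "C \<noteq> D"
    then obtain x y where xy: "C = coset L x" "D = coset L y" by (auto simp: cosets_eq_range)
    show "C \<inter> D = {}"
    proof (rule ccontr)
      assume "C \<inter> D \<noteq> {}"
      then obtain a b where ab: "a \<in> L" "b \<in> L" "x + a = y + b" by (auto simp: xy coset_def)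
      have "y = (x + a) + b"
        unfolding ab(3) by (simp add: add.assoc vec_add_self)
      then have "x + y = a + b" by (simp add: add.assoc vec_add_left_self)
      then have "x + y \<in> L" using ab L by (simp add: vec.subspace_add)
      then show False using ne xy coset_eq_iff[OF L] by metis
    qed
  qed simp_all
  also have "\<Union>(cosets L) = UNIV"
    using vec.subspace_0[OF L] by (force simp: cosets_eq_range coset_def)
  also have "card (UNIV :: (bit ^ 'n) set) = 2 ^ CARD('n)"
    by (simp add: UNIV_bit numeral_2_eq_2)
  \<comment> \<open>The dimension of \<open>L\<close> is at most \<open>CARD('n)\<close>, so the
    truncated subtraction is exact.\<close>
  also have "(2::nat) ^ CARD('n) = 2 ^ vec.dim L * 2 ^ (CARD('n) - vec.dim L)"
    using vec.dim_subset[of L UNIV] by (simp add: vec_dim_card del: vec.dim_UNIV flip: power_add)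
  finally show ?thesis
    unfolding cardL by (rule mult_left_cancel[THEN iffD1, rotated]) simp
qed

text \<open>The image of the cube edge of color \<open>i\<close> at \<open>x\<close>. Naming edges
  by vectors pulls dashings back to the cube; one edge has several names.\<close>

definition edge :: "(bit ^ 'n) set \<Rightarrow> bit ^ 'n \<Rightarrow> 'n \<Rightarrow> 'n \<times> (bit ^ 'n) set set" where
  "edge L x i = (i, {coset L x, coset L (x + axis i 1)})"

lemma ends_edge: "ends (quotient_cube L) (edge L x i) = {coset L x, coset L (x + axis i 1)}"
  by (simp add: edge_def quotient_cube_def)

lemma color_edge: "color (quotient_cube L) (edge L x i) = i"
  by (simp add: edge_def quotient_cube_def)

lemma edges_quotient_cube: "edges (quotient_cube L) = {edge L x i | x i. True}"
  by (auto simp: quotient_cube_def cosets_eq_range edge_def simp flip: translate_coset)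

lemma edge_in_edges: "edge L x i \<in> edges (quotient_cube L)"
  by (auto simp: edges_quotient_cube)

lemma edge_cong: "coset L x = coset L y \<Longrightarrow> edge L x i = edge L y i"
  by (simp add: edge_def coset_add_cong[of L x y])

lemma edge_add_axis: "edge L (x + axis i 1) i = edge L x i"
  by (simp add: edge_def add.assoc vec_add_self insert_commute)

text \<open>Lifting to the cube: an edge leaving the coset of \<open>x\<close> lifts to a cube edge
  leaving \<open>x\<close> itself, whichever representative and end it was named by.\<close>

lemma edge_at_coset:
  assumes "e \<in> edges (quotient_cube L)" and "ends (quotient_cube L) e = {coset L x, w}"
  obtains i where "e = edge L x i" "w = coset L (x + axis i 1)"
proof -
  obtain y i where e: "e = edge L y i"
    using assms(1) by (auto simp: edges_quotient_cube)
  then have *: "{coset L y, coset L (y + axis i 1)} = {coset L x, w}"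
    using assms(2) by (simp add: ends_edge)
  then consider "coset L x = coset L y" "w = coset L (y + axis i 1)"
    | "coset L x = coset L (y + axis i 1)" "w = coset L y"
    by (auto simp: doubleton_eq_iff)
  then show ?thesis
  proof cases
    case 1
    then show ?thesis
      using that[of i] e edge_cong[of L x y i] coset_add_cong[of L x y "axis i 1"] by metis
  next
    case 2
    have "e = edge L x i"
      using e edge_cong[OF 2(1), of i] by (simp add: edge_add_axis)
    moreover have "coset L (x + axis i 1) = coset L y"
      using coset_add_cong[OF 2(1), of "axis i 1"] by (simp add: add.assoc vec_add_self)
    ultimately show ?thesis using that 2 by metis
  qed
qed

text \<open>A basis vector in \<open>L\<close> would turn the edges of its color into loops.\<close>

lemma axis_notin_of_simple:
  fixes L :: "(bit ^ 'n::finite) set"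
  assumes "vec.subspace L" and "simple_graph (quotient_cube L)"
  shows "axis i 1 \<notin> L"
proof
  assume "axis i 1 \<in> L"
  then have "coset L 0 = coset L (0 + axis i 1)"
    using coset_eq_iff[OF assms(1), of 0 "axis i 1"] by simp
  then have "card (ends (quotient_cube L) (edge L 0 i)) = 1"
    by (simp add: ends_edge del: add_0)
  then show False
    using assms(2) edge_in_edges[of L 0 i] by (auto simp: simple_graph_def)
qed

text \<open>Otherwise the edges of colors \<open>i\<close> and \<open>j\<close> at the coset
  \<open>L\<close> would be parallel.\<close>

lemma axis_add_axis_notin_of_simple:
  fixes L :: "(bit ^ 'n::finite) set"
  assumes L: "vec.subspace L" and S: "simple_graph (quotient_cube L)" and ij: "i \<noteq> j"
  shows "axis i 1 + axis j 1 \<notin> L"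
proof
  assume "axis i 1 + axis j 1 \<in> L"
  then have "coset L (0 + axis i 1) = coset L (0 + axis j 1)"
    using coset_eq_iff[OF L, of "axis i 1" "axis j 1"] by simp
  then have "ends (quotient_cube L) (edge L 0 i) = ends (quotient_cube L) (edge L 0 j)"
    by (simp add: ends_edge del: add_0)
  then have "edge L 0 i = edge L 0 j"
    using S edge_in_edges[of L 0] by (auto simp: simple_graph_def dest: inj_onD)
  then show False using ij by (simp add: edge_def)
qed

section \<open>Two-colored 4-cycles\<close>

text \<open>The image of the 2-face of the cube at \<open>x\<close> in directions \<open>i\<close>
  and \<open>j\<close>, with its edges in cyclic order.\<close>

definition square :: "(bit ^ 'n) set \<Rightarrow> bit ^ 'n \<Rightarrow> 'n \<Rightarrow> 'n \<Rightarrow> ('n \<times> (bit ^ 'n) set set) set" where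
  "square L x i j =
     {edge L x i, edge L (x + axis i 1) j, edge L (x + axis j 1) i, edge L x j}"

text \<open>Simplicity keeps the four corners of a square distinct, so squares are 4-cycles.
  Conversely, a two-colored 4-cycle lifts step by step to the cube, where its colors must
  alternate.\<close>

lemma two_colored_four_cycles_quotient_cube:
  fixes L :: "(bit ^ 'n::finite) set"
  assumes L: "vec.subspace L" and S: "simple_graph (quotient_cube L)"
  shows "two_colored_four_cycles (quotient_cube L) = {square L x i j | x i j. i \<noteq> j}"
proof (intro set_eqI iffI)
  fix F assume "F \<in> {square L x i j | x i j. i \<noteq> j}"
  then obtain x i j where F: "F = square L x i j" and ij: "i \<noteq> j" by blast
  have 3: "edge L (x + axis j 1) i = edge L (x + axis i 1 + axis j 1) i"
    using edge_add_axis[of L "x + axis j 1" i] by (simp add: ac_simps)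
  have "four_cycle (quotient_cube L) F"
    unfolding four_cycle_def
  proof (intro exI conjI)
    show "F = {edge L x i, edge L (x + axis i 1) j, edge L (x + axis j 1) i, edge L x j}"
      by (simp add: F square_def)
    show "F \<subseteq> edges (quotient_cube L)"
      by (auto simp: F square_def edge_in_edges)
    show "ends (quotient_cube L) (edge L x i) = {coset L x, coset L (x + axis i 1)}"
      "ends (quotient_cube L) (edge L (x + axis i 1) j)
        = {coset L (x + axis i 1), coset L (x + axis i 1 + axis j 1)}"
      "ends (quotient_cube L) (edge L x j) = {coset L (x + axis j 1), coset L x}"
      by (auto simp: ends_edge)
    show "ends (quotient_cube L) (edge L (x + axis j 1) i)
        = {coset L (x + axis i 1 + axis j 1), coset L (x + axis j 1)}"
      by (auto simp: ends_edge add.assoc add.commute[of "axis i 1"])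
    show "distinct [coset L x, coset L (x + axis i 1), coset L (x + axis i 1 + axis j 1),
        coset L (x + axis j 1)]"
      using axis_notin_of_simple[OF L S] axis_add_axis_notin_of_simple[OF L S ij]
      by (simp add: coset_eq_iff[OF L] vec_ac)
  qed
  moreover have "color (quotient_cube L) ` F = {i, j}"
    by (auto simp: F square_def color_edge)
  ultimately show "F \<in> two_colored_four_cycles (quotient_cube L)"
    using ij by (auto simp: two_colored_four_cycles_def)
next
  fix F assume "F \<in> two_colored_four_cycles (quotient_cube L)"
  then obtain i j where fc: "four_cycle (quotient_cube L) F" and ij: "i \<noteq> j"
    and col: "color (quotient_cube L) ` F = {i, j}"
    by (auto simp: two_colored_four_cycles_def)
  obtain e1 e2 e3 e4 v1 v2 v3 v4 where d: "distinct [v1, v2, v3, v4]"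
    and F: "F = {e1, e2, e3, e4}" "F \<subseteq> edges (quotient_cube L)"
    and E: "ends (quotient_cube L) e1 = {v1, v2}" "ends (quotient_cube L) e2 = {v2, v3}"
      "ends (quotient_cube L) e3 = {v3, v4}" "ends (quotient_cube L) e4 = {v4, v1}"
    using fc unfolding four_cycle_def by (elim exE conjE)
  have edges: "e1 \<in> edges (quotient_cube L)" "e2 \<in> edges (quotient_cube L)"
    "e3 \<in> edges (quotient_cube L)" "e4 \<in> edges (quotient_cube L)"
    using F by auto
  obtain y i' where y: "e1 = edge L y i'"
    using edges(1) by (auto simp: edges_quotient_cube)
  obtain x where x: "v1 = coset L x"
    using E(1) y by (auto simp: ends_edge doubleton_eq_iff)
  obtain i1 where 1: "e1 = edge L x i1" "v2 = coset L (x + axis i1 1)"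
    using edge_at_coset[OF edges(1)] E(1) x by metis
  obtain i2 where 2: "e2 = edge L (x + axis i1 1) i2" "v3 = coset L (x + axis i1 1 + axis i2 1)"
    using edge_at_coset[OF edges(2)] E(2) 1 by metis
  obtain i3 where 3: "e3 = edge L (x + axis i1 1 + axis i2 1) i3"
    "v4 = coset L (x + axis i1 1 + axis i2 1 + axis i3 1)"
    using edge_at_coset[OF edges(3)] E(3) 2 by metis
  have "ends (quotient_cube L) e4 = {v1, v4}" using E(4) by auto
  then obtain i4 where 4: "e4 = edge L x i4" "v4 = coset L (x + axis i4 1)"
    using edge_at_coset[OF edges(4)] x by metis
  \<comment> \<open>Repeating a color on consecutive edges would lead back to the vertex just left,
    against distinctness. With only two colors available, they alternate.\<close>
  have "i1 \<noteq> i2"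
    using d x 2 by (auto simp: add.assoc vec_add_self)
  moreover have "i2 \<noteq> i3"
    using d 1 3 by (auto simp: add.assoc vec_add_self)
  moreover have "i4 \<noteq> i1"
    using d 1 4 by auto
  moreover have "i1 \<in> {i, j}" "i2 \<in> {i, j}" "i3 \<in> {i, j}" "i4 \<in> {i, j}"
    using col by (auto simp: F 1 2 3 4 color_edge)
  ultimately have "i3 = i1" "i4 = i2" by auto
  moreover have "edge L (x + axis i1 1 + axis i2 1) i1 = edge L (x + axis i2 1) i1"
    using edge_add_axis[of L "x + axis i2 1" i1] by (simp add: ac_simps)
  ultimately have "F = square L x i1 i2"
    by (auto simp: F 1 2 3 4 square_def)
  then show "F \<in> {square L x i j | x i j. i \<noteq> j}"
    using \<open>i1 \<noteq> i2\<close> by blast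
qed

text \<open>The sum runs over a set, so the four edges must be distinct. Edges of different colors
  always are; opposite edges are by simplicity.\<close>

lemma sum_square:
  fixes L :: "(bit ^ 'n::finite) set"
  assumes L: "vec.subspace L" and S: "simple_graph (quotient_cube L)" and ij: "i \<noteq> j"
  shows "(\<Sum>e\<in>square L x i j. d e) =
    d (edge L x i) + d (edge L (x + axis i 1) j) + d (edge L (x + axis j 1) i) + d (edge L x j)"
proof -
  have ne: "edge L (x + axis k 1) l \<noteq> edge L x l" if "k \<noteq> l" for k l
  proof -
    have "coset L (x + axis k 1) \<noteq> coset L x"
      using axis_notin_of_simple[OF L S] by (simp add: coset_eq_iff[OF L] vec_ac)
    moreover have "coset L (x + axis k 1) \<noteq> coset L (x + axis l 1)"
      using axis_add_axis_notin_of_simple[OF L S that] by (simp add: coset_eq_iff[OF L] vec_ac)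
    ultimately show ?thesis by (auto simp: edge_def doubleton_eq_iff)
  qed
  have ne': "edge L y k \<noteq> edge L z l" if "k \<noteq> l" for y z k l
    using that by (simp add: edge_def)
  have sum4: "(\<Sum>e\<in>{a, b, a', b'}. d e) = d a + d b + d a' + d b'"
    if "a \<noteq> a'" "b \<noteq> b'" "a \<noteq> b" "a \<noteq> b'" "b \<noteq> a'" "a' \<noteq> b'" for a b a' b'
    using that by (simp add: add.assoc)
  show ?thesis
    unfolding square_def
    by (rule sum4[OF ne[OF ij[symmetric], symmetric] ne[OF ij] ne'[OF ij] ne'[OF ij]
          ne'[OF ij[symmetric]] ne'[OF ij]])
qed

section \<open>Counting even dashings\<close>

lemma even_dashings_quotient_cube:
  fixes L :: "(bit ^ 'n::finite) set"
  assumes L: "vec.subspace L" and S: "simple_graph (quotient_cube L)"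
  shows "d \<in> even_dashings (quotient_cube L) \<longleftrightarrow>
    d \<in> dashings (quotient_cube L) \<and>
    (\<forall>x i j. d (edge L x i) + d (edge L (x + axis i 1) j) =
             d (edge L x j) + d (edge L (x + axis j 1) i))"
    (is "_ \<longleftrightarrow> _ \<and> ?closed")
proof -
  have "(\<Sum>e\<in>square L x i j. d e) = 0 \<longleftrightarrow>
      d (edge L x i) + d (edge L (x + axis i 1) j) =
      d (edge L x j) + d (edge L (x + axis j 1) i)" if "i \<noteq> j" for x i j
    unfolding sum_square[OF L S that] by (rule bit_sum4_eq_0_iff)
  then have "(\<forall>F\<in>two_colored_four_cycles (quotient_cube L). (\<Sum>e\<in>F. d e) = 0) \<longleftrightarrow>
      (\<forall>x i j. i \<noteq> j \<longrightarrow> d (edge L x i) + d (edge L (x + axis i 1) j) =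
        d (edge L x j) + d (edge L (x + axis j 1) i))"
    unfolding two_colored_four_cycles_quotient_cube[OF L S] by blast
  also have "\<dots> \<longleftrightarrow> ?closed"
    by metis
  finally show ?thesis by (simp add: even_dashings_def)
qed

text \<open>For additive \<open>\<phi>\<close>, this is the coboundary of the potential sending
  \<open>x\<close> to \<open>c (coset L x) + \<phi> x\<close>. It descends to the quotient because
  the increment of \<open>\<phi>\<close> along an edge depends only on the color.\<close>

definition dashing_of ::
    "(bit ^ 'n) set \<Rightarrow> ((bit ^ 'n) set \<Rightarrow> bit) \<Rightarrow> (bit ^ 'n \<Rightarrow> bit) \<Rightarrow>
      'n \<times> (bit ^ 'n) set set \<Rightarrow> bit" where
  "dashing_of L c \<phi> =
     (\<lambda>e\<in>edges (quotient_cube L). (\<Sum>C\<in>snd e. c C) + \<phi> (axis (fst e) 1))"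

lemma dashing_of_edge:
  fixes L :: "(bit ^ 'n::finite) set"
  assumes L: "vec.subspace L" and S: "simple_graph (quotient_cube L)"
  shows "dashing_of L c \<phi> (edge L x i) =
    c (coset L x) + c (coset L (x + axis i 1)) + \<phi> (axis i 1)"
proof -
  have "coset L x \<noteq> coset L (x + axis i 1)"
    using axis_notin_of_simple[OF L S] by (simp add: coset_eq_iff[OF L] vec_ac)
  then show ?thesis
    by (simp add: dashing_of_def edge_in_edges) (simp add: edge_def)
qed

text \<open>Around a square, the value of \<open>c\<close> at each corner and the value of
  \<open>\<phi>\<close> for each color occur twice and cancel.\<close>

lemma dashing_of_even:
  fixes L :: "(bit ^ 'n::finite) set"
  assumes "vec.subspace L" and "simple_graph (quotient_cube L)"
  shows "dashing_of L c \<phi> \<in> even_dashings (quotient_cube L)"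
proof -
  have "dashing_of L c \<phi> \<in> dashings (quotient_cube L)"
    by (auto simp: dashings_def dashing_of_def)
  then show ?thesis
    unfolding even_dashings_quotient_cube[OF assms]
    by (simp add: dashing_of_edge[OF assms] bit_ac)
qed

text \<open>
  The potential \<open>p\<close> on the cube of an even dashing satisfies \<open>p (x + l) = p x + p l\<close> for
  \<open>l \<in> L\<close>; subtracting a linear functional that agrees with \<open>p\<close> on \<open>L\<close> makes it constant
  on cosets.
\<close>

lemma even_dashing_eq_dashing_of:
  fixes L :: "(bit ^ 'n::finite) set"
  assumes L: "vec.subspace L" and S: "simple_graph (quotient_cube L)"
    and B: "B \<subseteq> L" "L \<subseteq> vec.span B"
    and \<phi>_add: "\<And>\<beta> x y. \<phi> \<beta> (x + y) = \<phi> \<beta> x + (\<phi> \<beta> y :: bit)"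
    and \<phi>_B: "\<And>\<beta> b. b \<in> B \<Longrightarrow> \<phi> \<beta> b = \<beta> b"
    and d: "d \<in> even_dashings (quotient_cube L)"
  obtains c \<beta> where "c \<in> cosets L \<rightarrow>\<^sub>E UNIV" "c L = 0" "\<beta> \<in> B \<rightarrow>\<^sub>E UNIV"
    and "d = dashing_of L c (\<phi> \<beta>)"
proof -
  have closed: "d (edge L x i) + d (edge L (x + axis i 1) j) =
      d (edge L x j) + d (edge L (x + axis j 1) i)" for x i j
    using d by (simp add: even_dashings_quotient_cube[OF L S])
  have dd: "d \<in> dashings (quotient_cube L)"
    using d by (simp add: even_dashings_def)
  obtain p where p: "\<And>x i. p (x + axis i 1) = p x + d (edge L x i)" and p0: "p 0 = 0"
    using cube_potential[of "\<lambda>x i. d (edge L x i)"] closed edge_add_axis by metis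
  \<comment> \<open>Walk from 0 to \<open>x\<close>. Since \<open>x\<close> and \<open>x + l\<close>
    lie in the same coset, both sides change by the dashing of the same edge at every step.\<close>
  have p_add: "p (x + l) = p x + p l" if "l \<in> L" for x l
  proof (induction x rule: bit_vec_axis_induct)
    case zero
    then show ?case by (simp add: p0)
  next
    case (axis x i)
    have "coset L (x + l) = coset L x"
      using that by (simp add: coset_eq_iff[OF L] vec_ac)
    then have "d (edge L (x + l) i) = d (edge L x i)"
      using edge_cong by metis
    then show ?case
      using p[of "x + l" i] axis p[of x i] by (simp add: ac_simps)
  qed
  define \<beta> where "\<beta> = restrict p B"
  have \<phi>0: "\<phi> \<beta> 0 = 0"
    using \<phi>_add[of \<beta> 0 0] by (simp add: bit_add_self)
  have p_L: "p l = \<phi> \<beta> l" if "l \<in> L" for l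
  proof (rule additive_eq_on_span[of p "\<phi> \<beta>" B])
    show "p (x + y) = p x + p y" if "y \<in> B" for x y
      using that B(1) p_add by blast
    show "p b = \<phi> \<beta> b" if "b \<in> B" for b
      using that by (simp add: \<phi>_B \<beta>_def)
  qed (use that B(2) \<phi>_add in \<open>auto simp: p0 \<phi>0\<close>)
  define rep where "rep C = (SOME x. coset L x = C)" for C
  \<comment> \<open>On \<open>L\<close> the functions \<open>p\<close> and
    \<open>\<phi> \<beta>\<close> agree, so their sum depends only on the coset and the choice of
    \<open>rep\<close> is immaterial.\<close>
  define c where "c = (\<lambda>C\<in>cosets L. p (rep C) + \<phi> \<beta> (rep C))"
  have c: "c (coset L x) = p x + \<phi> \<beta> x" for x
  proof -
    have "coset L (rep (coset L x)) = coset L x"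
      unfolding rep_def by (rule someI[of "\<lambda>y. coset L y = coset L x" x]) simp
    then have l: "rep (coset L x) + x \<in> L"
      by (simp add: coset_eq_iff[OF L])
    have "p (rep (coset L x)) = p x + p (rep (coset L x) + x)"
      using p_add[OF l, of x] by (simp add: vec_ac)
    moreover have "\<phi> \<beta> (rep (coset L x)) = \<phi> \<beta> x + \<phi> \<beta> (rep (coset L x) + x)"
      using \<phi>_add[of \<beta> x "rep (coset L x) + x"] by (simp add: vec_ac)
    ultimately show ?thesis
      using p_L[OF l] by (simp add: c_def cosets_eq_range bit_ac)
  qed
  show ?thesis
  proof (rule that)
    show "c \<in> cosets L \<rightarrow>\<^sub>E UNIV" by (simp add: c_def)
    show "c L = 0" using c[of 0] by (simp add: coset_0 p0 \<phi>0)
    show "\<beta> \<in> B \<rightarrow>\<^sub>E UNIV" by (simp add: \<beta>_def)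
    show "d = dashing_of L c (\<phi> \<beta>)"
    proof (rule PiE_ext[of _ "edges (quotient_cube L)" "\<lambda>_. UNIV"])
      show "d \<in> edges (quotient_cube L) \<rightarrow>\<^sub>E UNIV"
        using dd by (simp add: dashings_def)
      show "dashing_of L c (\<phi> \<beta>) \<in> edges (quotient_cube L) \<rightarrow>\<^sub>E UNIV"
        by (auto simp: dashing_of_def)
    next
      fix e assume "e \<in> edges (quotient_cube L)"
      then obtain x i where e: "e = edge L x i" by (auto simp: edges_quotient_cube)
      show "d e = dashing_of L c (\<phi> \<beta>) e"
        unfolding e dashing_of_edge[OF L S] c by (simp add: p \<phi>_add bit_ac)
    qed
  qed
qed

text \<open>Both sides are potentials of the same cochain on the cube and vanish at 0, so they agree
  along every walk from 0.\<close>

lemma dashing_of_eq_imp_potential_eq: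
  fixes L :: "(bit ^ 'n::finite) set"
  assumes L: "vec.subspace L" and S: "simple_graph (quotient_cube L)"
    and \<phi>: "\<And>x y. \<phi> (x + y) = \<phi> x + (\<phi> y :: bit)" and \<psi>: "\<And>x y. \<psi> (x + y) = \<psi> x + (\<psi> y :: bit)"
    and "c L = 0" "c' L = 0"
    and eq: "dashing_of L c \<phi> = dashing_of L c' \<psi>"
  shows "c (coset L x) + \<phi> x = c' (coset L x) + \<psi> x"
proof (induction x rule: bit_vec_axis_induct)
  case zero
  then show ?case
    using \<phi>[of 0 0] \<psi>[of 0 0] assms(5,6) by (simp add: coset_0 bit_add_self)
next
  case (axis x i)
  have "c (coset L x) + c (coset L (x + axis i 1)) + \<phi> (axis i 1) =
      c' (coset L x) + c' (coset L (x + axis i 1)) + \<psi> (axis i 1)"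
    using fun_cong[OF eq, of "edge L x i"] by (simp add: dashing_of_edge[OF L S])
  then have "(c (coset L x) + \<phi> x) + (c (coset L (x + axis i 1)) + \<phi> (x + axis i 1)) =
      (c' (coset L x) + \<psi> x) + (c' (coset L (x + axis i 1)) + \<psi> (x + axis i 1))"
    by (simp add: \<phi> \<psi> bit_ac)
  then show ?case
    using axis by (metis bit_add_left_self)
qed

lemma card_even_dashings_quotient_cube:
  fixes L :: "(bit ^ 'n::finite) set"
  assumes L: "vec.subspace L" and S: "simple_graph (quotient_cube L)"
  shows "card (even_dashings (quotient_cube L)) =
    2 ^ (2 ^ (CARD('n) - vec.dim L) + vec.dim L - 1)"
proof -
  obtain B where B: "B \<subseteq> L" "vec.independent B" "L \<subseteq> vec.span B" "card B = vec.dim L"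
    using vec.basis_exists by blast
  \<comment> \<open>One functional is fixed for each choice of values on the basis. Functionals that
    agree on \<open>B\<close> may differ off \<open>L\<close>, and that difference would have to be
    absorbed by \<open>c\<close>.\<close>
  obtain \<phi> where \<phi>_add: "\<And>\<beta> x y. \<phi> \<beta> (x + y) = \<phi> \<beta> x + (\<phi> \<beta> y :: bit)"
    and \<phi>_B: "\<And>\<beta> b. b \<in> B \<Longrightarrow> \<phi> \<beta> b = \<beta> b"
    using additive_extension[OF B(2)] by metis
  \<comment> \<open>The value at the coset \<open>L\<close> is pinned to 0, since adding a constant
    to a potential does not change its dashing.\<close>
  define T where "T = (\<Pi>\<^sub>E C\<in>cosets L. if C = L then {0::bit} else UNIV)"
  define U where "U = (B \<rightarrow>\<^sub>E (UNIV :: bit set))"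
  define \<Phi> where "\<Phi> = (\<lambda>(c, \<beta>). dashing_of L c (\<phi> \<beta>))"
  have LC: "L \<in> cosets L"
    unfolding cosets_eq_range using coset_0 by (metis rangeI)
  have T: "c \<in> T \<longleftrightarrow> c \<in> cosets L \<rightarrow>\<^sub>E UNIV \<and> c L = 0" for c
    using LC by (auto simp: T_def PiE_iff split: if_splits)
  have "inj_on \<Phi> (T \<times> U)"
  proof (intro inj_onI, clarify)
    fix c \<beta> c' \<beta>'
    assume *: "c \<in> T" "c' \<in> T" "\<beta> \<in> U" "\<beta>' \<in> U" and "\<Phi> (c, \<beta>) = \<Phi> (c', \<beta>')"
    then have eq: "c (coset L x) + \<phi> \<beta> x = c' (coset L x) + \<phi> \<beta>' x" for x
      by (intro dashing_of_eq_imp_potential_eq[OF L S]) (auto simp: T \<Phi>_def \<phi>_add)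
    \<comment> \<open>A basis vector lies in the coset \<open>L\<close>, where \<open>c\<close> and
      \<open>c'\<close> vanish, so the common potential there reads off \<open>\<beta>\<close> and
      \<open>\<beta>'\<close>.\<close>
    have "\<beta> = \<beta>'"
    proof (rule PiE_ext)
      show "\<beta> \<in> B \<rightarrow>\<^sub>E UNIV" "\<beta>' \<in> B \<rightarrow>\<^sub>E UNIV" using * by (simp_all add: U_def)
      fix b assume b: "b \<in> B"
      then have "coset L b = L"
        using B(1) coset_eq_iff[OF L, of b 0] by (auto simp: coset_0)
      then show "\<beta> b = \<beta>' b"
        using eq[of b] * b by (simp add: T \<phi>_B)
    qed
    moreover have "c = c'"
    proof (rule PiE_ext)
      show "c \<in> cosets L \<rightarrow>\<^sub>E UNIV" "c' \<in> cosets L \<rightarrow>\<^sub>E UNIV" using * by (simp_all add: T)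
      fix C assume "C \<in> cosets L"
      then obtain x where "C = coset L x" by (auto simp: cosets_eq_range)
      then show "c C = c' C" using eq[of x] \<open>\<beta> = \<beta>'\<close> by simp
    qed
    ultimately show "c = c' \<and> \<beta> = \<beta>'" by simp
  qed
  moreover have "\<Phi> ` (T \<times> U) = even_dashings (quotient_cube L)"
  proof
    show "\<Phi> ` (T \<times> U) \<subseteq> even_dashings (quotient_cube L)"
      using dashing_of_even[OF L S] by (auto simp: \<Phi>_def)
    show "even_dashings (quotient_cube L) \<subseteq> \<Phi> ` (T \<times> U)"
    proof
      fix d assume "d \<in> even_dashings (quotient_cube L)"
      then obtain c \<beta> where "c \<in> cosets L \<rightarrow>\<^sub>E UNIV" "c L = 0" "\<beta> \<in> B \<rightarrow>\<^sub>E UNIV"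
        "d = dashing_of L c (\<phi> \<beta>)"
        using even_dashing_eq_dashing_of[where \<phi> = \<phi>, OF L S B(1,3) \<phi>_add \<phi>_B] by metis
      then show "d \<in> \<Phi> ` (T \<times> U)"
        by (intro image_eqI[of _ _ "(c, \<beta>)"]) (simp_all add: \<Phi>_def T U_def)
    qed
  qed
  ultimately have "card (even_dashings (quotient_cube L)) = card (T \<times> U)"
    by (metis card_image)
  also have "\<dots> = card T * card U"
    by (rule card_cartesian_product)
  also have "card T = 2 ^ (card (cosets L) - 1)"
  proof -
    have "card T = (\<Prod>C\<in>cosets L. if C = L then 1 else 2)"
      by (simp add: T_def card_PiE UNIV_bit if_distrib numeral_2_eq_2 cong: if_cong)
    also have "\<dots> = (\<Prod>C\<in>cosets L - {L}. 2)"
      using LC by (subst prod.remove[of _ L]) auto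
    finally show ?thesis using LC by simp
  qed
  also have "card U = 2 ^ card B"
    by (simp add: U_def card_funcsetE UNIV_bit numeral_2_eq_2)
  finally have "card (even_dashings (quotient_cube L)) = 2 ^ (card (cosets L) - 1 + card B)"
    by (simp only: power_add)
  \<comment> \<open>There is at least one coset, so the truncated subtraction of 1 may be moved to
    the end.\<close>
  moreover have "card (cosets L) - 1 + card B = 2 ^ (CARD('n) - vec.dim L) + vec.dim L - 1"
    unfolding card_cosets[OF L] B(4) by (rule add_diff_assoc2) simp
  ultimately show ?thesis by (simp only:)
qed

section \<open>Counting odd dashings\<close>

text \<open>Translation by a fixed odd dashing adds 1 to the sum over every two-colored 4-cycle and
  is its own inverse.\<close>

lemma card_odd_dashings_eq_even:
  assumes "odd_dashings A \<noteq> {}"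
  shows "card (odd_dashings A) = card (even_dashings A)"
proof -
  obtain d0 where d0: "d0 \<in> odd_dashings A" using assms by blast
  \<comment> \<open>The restriction to the edge set keeps the translate extensional, hence a
    dashing.\<close>
  define t where "t d = (\<lambda>e\<in>edges A. d e + d0 e)" for d
  have t_sum: "(\<Sum>e\<in>F. t d e) = (\<Sum>e\<in>F. d e) + 1" if "F \<in> two_colored_four_cycles A" for d F
  proof -
    have "F \<subseteq> edges A"
      using that by (auto simp: two_colored_four_cycles_def four_cycle_def)
    then have "(\<Sum>e\<in>F. t d e) = (\<Sum>e\<in>F. d e + d0 e)"
      by (intro sum.cong) (auto simp: t_def)
    also have "\<dots> = (\<Sum>e\<in>F. d e) + (\<Sum>e\<in>F. d0 e)" by (rule sum.distrib)
    finally show ?thesis using d0 that by (simp add: odd_dashings_def)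
  qed
  have t_dash: "t d \<in> dashings A" for d
    by (simp add: t_def dashings_def)
  have t_t: "t (t d) = d" if "d \<in> dashings A" for d
    using that by (intro PiE_ext[of _ "edges A" "\<lambda>_. UNIV"])
      (auto simp: dashings_def t_def bit_ac)
  have "bij_betw t (odd_dashings A) (even_dashings A)"
    by (rule bij_betw_byWitness[where f' = t])
      (auto simp: odd_dashings_def even_dashings_def t_t t_dash t_sum bit_add_self)
  then show ?thesis by (rule bij_betw_same_card)
qed

theorem mainTheorem1:
  fixes L :: "(bit ^ 'n::finite) set" and k :: nat
  assumes "linear_code L"
    and "vec.dim L = k"
    and "chromotopology (quotient_cube L)"
    and "adinkraizable (quotient_cube L)"
  shows "card (even_dashings (quotient_cube L)) = 2 ^ (2 ^ (CARD('n) - k) + k - 1) \<and>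
         card (odd_dashings (quotient_cube L)) = 2 ^ (2 ^ (CARD('n) - k) + k - 1)"
  \<comment> \<open>A chromotopology is simple, as the even count requires, and adinkraizability
    supplies the odd dashing to translate by.\<close>
  using card_even_dashings_quotient_cube[of L] card_odd_dashings_eq_even[of "quotient_cube L"] assms
  by (simp add: linear_code_def chromotopology_def adinkraizable_def)

end
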